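(* Let $X$ be a topological space and let $\mathcal{C}^{\mathbb{C}}(X)$ be the ring of continuous complex valued functions on $X$. (1) Let $A=\begin{pmatrix} a& b\\ c& d\end{pmatrix}\in \mathrm{SL}_2(\mathcal{C}^{\mathbb{C}}(X))$ with $a(x)\neq 0$ for all $x\in X$. Then the functions $$z_1=\frac{c-\frac{a-1}{\sqrt{|a-1|}}}{a},\quad z_2=\sqrt{|a-1|},\quad z_3=\frac{a-1}{\sqrt{|a-1|}},\quad z_4=\frac{b-\sqrt{|a-1|}}{a}$$ are continuous, solve $$A=\begin{pmatrix}1&0\\ z_1&1\end{pmatrix}\begin{pmatrix}1&z_2\\ 0&1\end{pmatrix}\begin{pmatrix}1&0\\ z_3&1\end{pmatrix}\begin{pmatrix}1&z_4\\ 0&1\end{pmatrix},$$ and satisfy the interpolation condition: $A(x)=\mathrm{Id}\implies z_1(x)=z_2(x)=z_3(x)=z_4(x)=0$. (2) Let $f,a,b,c,d\in\mathcal{C}^{\mathbb{C}}(X)$ be such that $A=\begin{pmatrix}1+f^3a& f^3b\\ f^3c&1+f^3d\end{pmatrix}\in\mathrm{SL}_2(\mathcal{C}^{\mathbb{C}}(X))$ and $1+f^3a$ has no zeros on $X$. Then the functions $$z_1=\frac{f^2c-\frac{af}{\sqrt{|af|}}}{1+f^3a},\quad z_2=\sqrt{|af|},\quad z_3=\frac{af}{\sqrt{|af|}},\quad z_4=\frac{f^2b-\sqrt{|af|}}{1+f^3a}$$ are continuous, solve $$A=\begin{pmatrix}1&0\\ fz_1&1\end{pmatrix}\begin{pmatrix}1&fz_2\\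 0&1\end{pmatrix}\begin{pmatrix}1&0\\ fz_3&1\end{pmatrix}\begin{pmatrix}1&fz_4\\ 0&1\end{pmatrix},$$ and satisfy the interpolation condition: $A(x)=\mathrm{Id}\implies z_1(x)=z_2(x)=z_3(x)=z_4(x)=0$. (3) (Special Whitehead Lemma) For every nowhere vanishing $\lambda\in\mathcal{C}^{\mathbb{C}}(X)$, $$\begin{pmatrix}\lambda&0\\0&\lambda^{-1}\end{pmatrix}=\begin{pmatrix}1&0\\ \frac{1-\lambda}{\lambda\sqrt{|\lambda-1|}}&1\end{pmatrix}\begin{pmatrix}1&\sqrt{|\lambda-1|}\\0&1\end{pmatrix}\begin{pmatrix}1&0\\ \frac{\lambda-1}{\sqrt{|\lambda-1|}}&1\end{pmatrix}\begin{pmatrix}1&-\frac{\sqrt{|\lambda-1|}}{\lambda}\\0&1\end{pmatrix},$$ where the four off-diagonal entries on the right are continuous functions on $X$ which all vanish at every point $x$ where $\lambda(x)=1$ (i.e. where the diagonal matrix is the identity).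
   Context: For a complex valued function $g$, the expression $\frac{g}{\sqrt{|g|}}$ is understood to be $0$ at points where $g=0$. *)

theory Defs
  imports "HOL-Analysis.Analysis"
begin

text \<open>
  A function on the space \<open>X\<close> is represented by a HOL function on the underlying type,
  of which only the values on \<open>topspace X\<close> matter. Hence two elements of
  \<open>cont_fun X\<close> represent the same element of the ring of continuous complex valued
  functions iff they agree on \<open>topspace X\<close>. The ring operations are pointwise, so that
  an identity between matrices over that ring means the identity of their values at each
  point of \<open>topspace X\<close>.
\<close>

definition cont_fun :: "'a topology \<Rightarrow> ('a \<Rightarrow> complex) set" where
  "cont_fun X = {f. continuous_map X euclidean f}"

definition mat2 :: "'r \<Rightarrow> 'r \<Rightarrow> 'r \<Rightarrow> 'r \<Rightarrow> 'r^2^2" where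
  "mat2 a b c d =
    (\<chi> i j. if i = 1 then (if j = 1 then a else b) else (if j = 1 then c else d))"

definition mat_at :: "('a \<Rightarrow> 'r)^2^2 \<Rightarrow> 'a \<Rightarrow> 'r^2^2" where
  "mat_at A x = (\<chi> i j. (A $ i $ j) x)"

definition SL2_cont :: "'a topology \<Rightarrow> (('a \<Rightarrow> complex)^2^2) set" where
  "SL2_cont X =
    {A. (\<forall>i j. A $ i $ j \<in> cont_fun X) \<and> (\<forall>x \<in> topspace X. det (mat_at A x) = 1)}"

definition lower_unip :: "complex \<Rightarrow> complex^2^2" where
  "lower_unip z = mat2 1 0 z 1"

definition upper_unip :: "complex \<Rightarrow> complex^2^2" where
  "upper_unip z = mat2 1 z 0 1"

text \<open>
  The convention that \<open>g / sqrt \<bar>g\<bar>\<close> is \<open>0\<close> where \<open>g = 0\<close>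
  needs no case distinction, because division by zero yields \<open>0\<close> in HOL.
\<close>

definition sqrt_abs :: "complex \<Rightarrow> complex" where
  "sqrt_abs w = complex_of_real (sqrt (cmod w))"

end

theory Submission
  imports Defs
begin

text \<open>
  The product of the four unipotent matrices has the entries
  \<open>1 + z2 z3\<close>, \<open>z2 + (1 + z2 z3) z4\<close> and \<open>z3 + z1 (1 + z2 z3)\<close> outside of the
  lower right corner, and that corner is then determined by the determinant. So one needs
  a factorization \<open>z2 z3 = a - 1\<close> into continuous functions vanishing where \<open>a = 1\<close>;
  with \<open>w = a - 1\<close> such a factorization is \<open>z2 = sqrt \<bar>w\<bar>\<close> and
  \<open>z3 = w / sqrt \<bar>w\<bar>\<close>, the latter being continuous at the zeros of \<open>w\<close> because its
  absolute value is \<open>sqrt \<bar>w\<bar>\<close>. Part (3) is part (1) for the diagonal matrix, and part (2)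
  uses \<open>w = a f\<close>, where the remaining factor \<open>f\<^sup>2\<close> of \<open>f\<^sup>3 a\<close> is
  distributed over the two middle matrices.
\<close>

lemma sqrt_abs_eq_0_iff [simp]: "sqrt_abs w = 0 \<longleftrightarrow> w = 0"
  by (simp add: sqrt_abs_def)

lemma norm_sqrt_abs: "norm (sqrt_abs w) = sqrt (norm w)"
  by (simp add: sqrt_abs_def)

lemma norm_div_sqrt_abs: "norm (w / sqrt_abs w) = sqrt (norm w)"
  by (simp add: norm_divide norm_sqrt_abs real_div_sqrt)

text \<open>This needs no assumption on \<open>w\<close>: the divisor vanishes only at
  \<open>w = 0\<close>, where both sides are \<open>0\<close>.\<close>

lemma sqrt_abs_mult_div_sqrt_abs: "sqrt_abs w * (w / sqrt_abs w) = w"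
  by simp

lemma continuous_on_sqrt_abs: "continuous_on UNIV sqrt_abs"
  unfolding sqrt_abs_def by (intro continuous_intros)

lemma continuous_on_div_sqrt_abs: "continuous_on UNIV (\<lambda>w. w / sqrt_abs w)"
proof -
  have "isCont (\<lambda>w. w / sqrt_abs w) w" for w
  proof (cases "w = 0")
    case True
    have "((\<lambda>v::complex. sqrt (norm v)) \<longlongrightarrow> sqrt (norm (0::complex))) (at 0)"
      by (intro tendsto_intros)
    then have "((\<lambda>v. v / sqrt_abs v) \<longlongrightarrow> 0) (at 0)"
      by (intro tendsto_norm_zero_cancel[where f = "\<lambda>v. v / sqrt_abs v"])
        (simp only: norm_div_sqrt_abs norm_zero real_sqrt_zero)
    \<comment> \<open>The limit agrees with the value of the quotient at \<open>0\<close>, because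
      \<open>0 / 0 = 0\<close>.\<close>
    with True show ?thesis
      by (simp add: isCont_def)
  next
    case False
    have "isCont sqrt_abs w"
      using continuous_on_sqrt_abs by (simp add: continuous_on_eq_continuous_at)
    with False show ?thesis
      by (intro continuous_intros) simp_all
  qed
  then show ?thesis
    by (simp add: continuous_on_eq_continuous_at)
qed

text \<open>Reduces continuity on the abstract space \<open>X\<close> to continuity on the complex
  plane, where the two functions built from \<open>sqrt_abs\<close> have been treated.\<close>

lemma cont_fun_compose:
  assumes "continuous_on UNIV h" "g \<in> cont_fun X"
  shows "(\<lambda>x. h (g x)) \<in> cont_fun X"
  using continuous_map_compose[of X euclidean g euclidean h] assms
  by (simp add: cont_fun_def o_def)

lemmas cont_fun_sqrt_abs = cont_fun_compose[OF continuous_on_sqrt_abs]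
  and cont_fun_div_sqrt_abs = cont_fun_compose[OF continuous_on_div_sqrt_abs]

lemma cont_fun_const: "(\<lambda>x. k) \<in> cont_fun X"
  by (simp add: cont_fun_def)

lemma cont_fun_diff:
  "g \<in> cont_fun X \<Longrightarrow> h \<in> cont_fun X \<Longrightarrow> (\<lambda>x. g x - h x) \<in> cont_fun X"
  by (simp add: cont_fun_def continuous_map_diff)

lemma cont_fun_mult:
  "g \<in> cont_fun X \<Longrightarrow> h \<in> cont_fun X \<Longrightarrow> (\<lambda>x. g x * h x) \<in> cont_fun X"
  by (simp add: cont_fun_def continuous_map_atin tendsto_mult)

lemma cont_fun_power: "g \<in> cont_fun X \<Longrightarrow> (\<lambda>x. g x ^ n) \<in> cont_fun X"
  by (simp add: cont_fun_def continuous_map_atin tendsto_power)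

lemma cont_fun_divide:
  "g \<in> cont_fun X \<Longrightarrow> h \<in> cont_fun X \<Longrightarrow> \<forall>x \<in> topspace X. h x \<noteq> 0 \<Longrightarrow>
    (\<lambda>x. g x / h x) \<in> cont_fun X"
  by (simp add: cont_fun_def continuous_map_atin tendsto_divide)

lemmas cont_fun_intros =
  cont_fun_sqrt_abs cont_fun_div_sqrt_abs cont_fun_const cont_fun_diff
  cont_fun_mult cont_fun_power cont_fun_divide

lemma mat_at_mat2: "mat_at (mat2 a b c d) x = mat2 (a x) (b x) (c x) (d x)"
  by (simp add: mat_at_def mat2_def vec_eq_iff)

lemma mat2_eq_iff: "mat2 a b c d = mat2 a' b' c' d' \<longleftrightarrow> a = a' \<and> b = b' \<and> c = c' \<and> d = d'"
  by (auto simp: mat2_def vec_eq_iff forall_2)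

lemma mat2_mult:
  fixes a b c d a' b' c' d' :: "'r::semiring_1"
  shows "mat2 a b c d ** mat2 a' b' c' d' =
    mat2 (a * a' + b * c') (a * b' + b * d') (c * a' + d * c') (c * b' + d * d')"
  by (simp add: mat2_def matrix_matrix_mult_def vec_eq_iff forall_2 sum_2)

lemma mat_1_eq_mat2: "(mat 1 :: 'r::zero_neq_one^2^2) = mat2 1 0 0 1"
  by (simp add: mat_def mat2_def vec_eq_iff forall_2)

lemma det_mat2: "det (mat2 a b c d) = a * d - b * (c :: 'r::comm_ring_1)"
  by (simp add: det_2 mat2_def)

lemma SL2_cont_mat2:
  "mat2 a b c d \<in> SL2_cont X \<longleftrightarrow>
    a \<in> cont_fun X \<and> b \<in> cont_fun X \<and> c \<in> cont_fun X \<and> d \<in> cont_fun X \<and>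
    (\<forall>x \<in> topspace X. a x * d x - b x * c x = 1)"
  by (simp add: SL2_cont_def mat_at_mat2 det_mat2 forall_2) (simp add: mat2_def conj_assoc)

text \<open>Pointwise core of all three factorizations. Only the product \<open>z2 * z3\<close> is
  prescribed, so that the entries may carry the extra factor \<open>f\<close> of the second
  part.\<close>

lemma mat2_eq_unip_prod:
  assumes "a \<noteq> 0" and det: "a * d - b * c = 1"
    and z23: "z2 * z3 = a - 1" and z1: "z1 = (c - z3) / a" and z4: "z4 = (b - z2) / a"
  shows "mat2 a b c d = lower_unip z1 ** upper_unip z2 ** lower_unip z3 ** upper_unip z4"
proof -
  have c: "c = z1 * a + z3" and b: "b = a * z4 + z2"
    using assms(1) z1 z4 by simp_all
  \<comment> \<open>The bracket is the lower right corner of the product. Substituting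
    \<open>c\<close>, then \<open>b\<close>, into \<open>1 + b * c\<close> produces the factor
    \<open>a\<close>, which is cancelled next.\<close>
  have "a * d = a * (z1 * b + z3 * z4 + 1)"
    using det z23 b c by algebra
  then have "d = z1 * b + z3 * z4 + 1"
    using assms(1) by simp
  moreover have "a = 1 + z2 * z3"
    using z23 by simp
  ultimately show ?thesis
    using b c by (simp add: lower_unip_def upper_unip_def mat2_mult mat2_eq_iff algebra_simps)
qed

theorem lemma5p7:
  fixes X :: "'a topology"
  shows
    "(\<forall>a b c d :: 'a \<Rightarrow> complex.
        mat2 a b c d \<in> SL2_cont X \<longrightarrow> (\<forall>x \<in> topspace X. a x \<noteq> 0) \<longrightarrow>
        (let A = mat2 a b c d;
             z1 = (\<lambda>x. (c x - (a x - 1) / sqrt_abs (a x - 1)) / a x);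
             z2 = (\<lambda>x. sqrt_abs (a x - 1));
             z3 = (\<lambda>x. (a x - 1) / sqrt_abs (a x - 1));
             z4 = (\<lambda>x. (b x - sqrt_abs (a x - 1)) / a x)
         in z1 \<in> cont_fun X \<and> z2 \<in> cont_fun X \<and> z3 \<in> cont_fun X \<and> z4 \<in> cont_fun X \<and>
            (\<forall>x \<in> topspace X.
               mat_at A x = lower_unip (z1 x) ** upper_unip (z2 x)
                            ** lower_unip (z3 x) ** upper_unip (z4 x)) \<and>
            (\<forall>x \<in> topspace X. mat_at A x = mat 1 \<longrightarrow>
               z1 x = 0 \<and> z2 x = 0 \<and> z3 x = 0 \<and> z4 x = 0)))
   \<and>
     (\<forall>f a b c d :: 'a \<Rightarrow> complex.
        f \<in> cont_fun X \<longrightarrow> a \<in> cont_fun X \<longrightarrow> b \<in> cont_fun X \<longrightarrow>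
        c \<in> cont_fun X \<longrightarrow> d \<in> cont_fun X \<longrightarrow>
        (let A = mat2 (\<lambda>x. 1 + f x ^ 3 * a x) (\<lambda>x. f x ^ 3 * b x)
                      (\<lambda>x. f x ^ 3 * c x) (\<lambda>x. 1 + f x ^ 3 * d x);
             z1 = (\<lambda>x. (f x ^ 2 * c x - (a x * f x) / sqrt_abs (a x * f x))
                        / (1 + f x ^ 3 * a x));
             z2 = (\<lambda>x. sqrt_abs (a x * f x));
             z3 = (\<lambda>x. (a x * f x) / sqrt_abs (a x * f x));
             z4 = (\<lambda>x. (f x ^ 2 * b x - sqrt_abs (a x * f x)) / (1 + f x ^ 3 * a x))
         in A \<in> SL2_cont X \<longrightarrow> (\<forall>x \<in> topspace X. 1 + f x ^ 3 * a x \<noteq> 0) \<longrightarrow>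
            z1 \<in> cont_fun X \<and> z2 \<in> cont_fun X \<and> z3 \<in> cont_fun X \<and> z4 \<in> cont_fun X \<and>
            (\<forall>x \<in> topspace X.
               mat_at A x = lower_unip (f x * z1 x) ** upper_unip (f x * z2 x)
                            ** lower_unip (f x * z3 x) ** upper_unip (f x * z4 x)) \<and>
            (\<forall>x \<in> topspace X. mat_at A x = mat 1 \<longrightarrow>
               z1 x = 0 \<and> z2 x = 0 \<and> z3 x = 0 \<and> z4 x = 0)))
   \<and>
     (\<forall>l :: 'a \<Rightarrow> complex.
        l \<in> cont_fun X \<longrightarrow> (\<forall>x \<in> topspace X. l x \<noteq> 0) \<longrightarrow>
        (let z1 = (\<lambda>x. (1 - l x) / (l x * sqrt_abs (l x - 1)));
             z2 = (\<lambda>x. sqrt_abs (l x - 1));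
             z3 = (\<lambda>x. (l x - 1) / sqrt_abs (l x - 1));
             z4 = (\<lambda>x. - (sqrt_abs (l x - 1) / l x))
         in (\<forall>x \<in> topspace X.
               mat_at (mat2 l (\<lambda>x. 0) (\<lambda>x. 0) (\<lambda>x. inverse (l x))) x =
                 lower_unip (z1 x) ** upper_unip (z2 x)
                 ** lower_unip (z3 x) ** upper_unip (z4 x)) \<and>
            z1 \<in> cont_fun X \<and> z2 \<in> cont_fun X \<and> z3 \<in> cont_fun X \<and> z4 \<in> cont_fun X \<and>
            (\<forall>x \<in> topspace X. l x = 1 \<longrightarrow>
               z1 x = 0 \<and> z2 x = 0 \<and> z3 x = 0 \<and> z4 x = 0)))"
proof (intro conjI allI impI, goal_cases)
  case (1 a b c d)
  then have "a \<in> cont_fun X" "b \<in> cont_fun X" "c \<in> cont_fun X" "d \<in> cont_fun X"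
    and "\<forall>x \<in> topspace X. a x * d x - b x * c x = 1"
    by (simp_all add: SL2_cont_mat2)
  with 1 show ?case
    unfolding Let_def mat_at_mat2 mat_1_eq_mat2 mat2_eq_iff
    by (intro conjI ballI impI cont_fun_intros mat2_eq_unip_prod sqrt_abs_mult_div_sqrt_abs)
      simp_all
next
  case (2 f a b c d)
  show ?case
    unfolding Let_def mat_at_mat2 mat_1_eq_mat2 mat2_eq_iff SL2_cont_mat2
  proof (intro impI, elim conjE, intro conjI ballI impI, goal_cases)
    \<comment> \<open>This is the matrix identity. Both middle entries carry a factor
      \<open>f x\<close>, and their product is \<open>f x ^ 2 * (a x * f x)\<close>, the upper left
      entry minus \<open>1\<close>.\<close>
    case (5 x)
    have "(f x * sqrt_abs (a x * f x)) * (f x * (a x * f x / sqrt_abs (a x * f x)))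
        = f x ^ 2 * (sqrt_abs (a x * f x) * (a x * f x / sqrt_abs (a x * f x)))"
      by (simp only: power2_eq_square mult_ac)
    then have "(f x * sqrt_abs (a x * f x)) * (f x * (a x * f x / sqrt_abs (a x * f x)))
        = 1 + f x ^ 3 * a x - 1"
      by (simp only: sqrt_abs_mult_div_sqrt_abs) (simp add: power2_eq_square power3_eq_cube)
    \<comment> \<open>In the outer entries the factor \<open>f x\<close> turns
      \<open>f x ^ 2 * c x\<close> and \<open>f x ^ 2 * b x\<close> into the off-diagonal entries of
      the matrix.\<close>
    with 5 show ?case
      by (intro mat2_eq_unip_prod)
        (simp_all add: power2_eq_square power3_eq_cube right_diff_distrib mult.assoc)
  \<comment> \<open>For the interpolation condition, a vanishing \<open>f x ^ 3 * a x\<close> forces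
    \<open>f x = 0\<close> or \<open>a x = 0\<close>, hence \<open>a x * f x = 0\<close>; likewise
    for \<open>f x ^ 2 * b x\<close> and \<open>f x ^ 2 * c x\<close>.\<close>
  qed (use 2 in \<open>auto intro!: cont_fun_intros\<close>)
next
  case (3 l)
  \<comment> \<open>Brings the outer entries into the shape of the first part with zero off-diagonal
    entries. Both rewritings hold at every \<open>x\<close>, also where a denominator is
    \<open>0\<close>.\<close>
  have z1: "(1 - l x) / (l x * sqrt_abs (l x - 1))
      = (0 - (l x - 1) / sqrt_abs (l x - 1)) / l x" for x
    by (simp only: diff_0 minus_divide_left divide_divide_eq_left minus_diff_eq mult.commute)
  have z4: "- (sqrt_abs (l x - 1) / l x) = (0 - sqrt_abs (l x - 1)) / l x" for x
    by simp
  from 3 show ?case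
    unfolding Let_def mat_at_mat2 z1 z4
    by (intro conjI ballI impI cont_fun_intros mat2_eq_unip_prod sqrt_abs_mult_div_sqrt_abs)
      simp_all
qed

end
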